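(* Let $\mathbf{x}=(x_1,\dots,x_k)$ be a fixed vector of positive integers and let $r=\sum_{i=1}^k x_i$. Then \[ m(\mathbf{x},n)\geq\left(\frac{1}{c(\mathbf{x})\,x_1!x_2!\cdots x_k!}+o(1)\right)n^{r-k}, \] where $c(\mathbf{x})$ is the number of unordered partitions of an $r$-set into $k$ sets of sizes $x_1,x_2,\dots,x_k$, and $o(1)$ denotes a quantity tending to $0$ as $n\to\infty$ with $\mathbf{x}$ fixed.
   Context: $[n]=\{1,\dots,n\}$ and $[n]^{(r)}$ is the family of all $r$-element subsets of $[n]$. A Hamilton cycle in $K_n$ (on vertex set $[n]$) is regarded as a cyclic ordering $c_1,c_2,\dots,c_n$ of $[n]$, with indices taken modulo $n$. For $\mathbf{x}=(x_1,\dots,x_k)$ a vector of positive integers with $\sum_i x_i=r$ and a family $\mathcal{F}\subseteq[n]^{(r)}$, a Hamilton cycle $c_1,\dots,c_n$ is called $\mathbf{x}$-acceptable for (or with respect to) $\mathcal{F}$ if there do not exist $t_1,\dots,t_k$ with $\bigcup_{i=1}^k\{c_{t_i+1},c_{t_i+2},\dots,c_{t_i+x_i}\}\in\mathcal{F}$. Then $m(\mathbf{x},n)$ (for $n\ge r$) denotes the minimum of $|\mathcal{F}|$ over all families $\mathcal{F}\subseteq[n]^{(r)}$ such that $K_n$ does not contain an $\mathbf{x}$-acceptable Hamilton cycle with respect to $\mathcal{F}$. *)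

theory Defs
  imports Complex_Main "HOL-Library.Disjoint_Sets" "HOL-Library.Multiset"
    "HOL-Combinatorics.Multiset_Permutations"
begin

definition r_subsets :: "nat \<Rightarrow> nat \<Rightarrow> nat set set" where
  "r_subsets n r = {A. A \<subseteq> {1..n} \<and> card A = r}"

(* A Hamilton cycle c_1, ..., c_n of K_n is represented by a list cs with c_i = cs ! (i - 1).
   The cyclic ordering is its class under rotation, and every notion below is invariant
   under rotation of cs. *)
definition hamilton_cycles :: "nat \<Rightarrow> nat list set" where
  "hamilton_cycles n = permutations_of_set {1..n}"

(* {c_{t+1}, ..., c_{t+l}}, indices modulo n = length cs.  Natural numbers t suffice, since
   they represent every residue modulo n. *)
definition arc :: "nat list \<Rightarrow> nat \<Rightarrow> nat \<Rightarrow> nat set" where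
  "arc cs t l = (\<lambda>i. cs ! ((i - 1) mod length cs)) ` {t + 1..t + l}"

definition acceptable :: "nat list \<Rightarrow> nat set set \<Rightarrow> nat list \<Rightarrow> bool" where
  "acceptable x F cs \<longleftrightarrow>
     \<not> (\<exists>t :: nat \<Rightarrow> nat. (\<Union>i<length x. arc cs (t i) (x ! i)) \<in> F)"

(* Intended for n \<ge> sum_list x only: then the family of all r-subsets belongs to the set
   of families, so that the minimum is over a nonempty finite set. *)
definition m :: "nat list \<Rightarrow> nat \<Rightarrow> nat" where
  "m x n = Min (card ` {F. F \<subseteq> r_subsets n (sum_list x) \<and>
                          \<not> (\<exists>cs \<in> hamilton_cycles n. acceptable x F cs)})"

(* The entries of x are positive, so partition_on demanding nonempty parts loses nothing. *)
definition num_partitions :: "nat list \<Rightarrow> nat" where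
  "num_partitions x =
     card {P. partition_on {1..sum_list x} P \<and> image_mset card (mset_set P) = mset x}"

end

theory Submission imports Defs begin

text \<open>
  The proof is a union bound over all \<open>n!\<close> orderings \<open>cs\<close> of \<open>{1..n}\<close>. If no cycle is
  acceptable for \<open>F\<close>, then every ordering has some \<open>A \<in> F\<close> as a union of arcs of lengths
  \<open>x\<^sub>1, \<dots>, x\<^sub>k\<close>, so \<open>n!\<close> is at most \<open>|F|\<close> times the largest number of orderings in which one
  \<open>r\<close>-set \<open>A\<close> is such a union.

  To bound that number, note that \<open>|A| = r\<close> is the sum of the arc lengths, so the arcs are
  disjoint and partition \<open>A\<close> into parts of sizes \<open>x\<^sub>1, \<dots>, x\<^sub>k\<close>. The ordering is determined by this
  unordered partition (\<open>c(x)\<close> choices), the order in which each part is traversed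
  (\<open>\<Prod> x\<^sub>i!\<close> choices), the starting position of each part (at most \<open>n ^ k\<close> choices), and
  the order of the remaining elements (\<open>(n - r)!\<close> choices). This is
  \<open>has_layout_exists\<close>, \<open>has_layout_unique\<close> and \<open>card_layouts_le\<close>. Indexing orders and starting
  positions by the parts themselves, rather than by \<open>1, \<dots>, k\<close>, is what produces
  unordered partitions and makes a correction for equal entries of \<open>x\<close> unnecessary.

  Hence \<open>|F| \<ge> n! / ((n - r)! n ^ k c(x) \<Prod> x\<^sub>i!)\<close>, and \<open>n! / (n - r)!\<close> is
  \<open>n ^ r \<Prod>\<^bsub>i<r\<^esub> (1 - i / n) = (1 + o(1)) n ^ r\<close>.
\<close>

section \<open>Partitions into parts of prescribed sizes\<close>

text \<open>The partitions of \<open>A\<close> whose part sizes form the multiset of entries of \<open>x\<close>.\<close>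

definition sized_partitions :: "'a set \<Rightarrow> nat list \<Rightarrow> 'a set set set" where
  "sized_partitions A x = {P. partition_on A P \<and> image_mset card (mset_set P) = mset x}"

lemma finite_sized_partitions: "finite A \<Longrightarrow> finite (sized_partitions A x)"
  by (rule finite_subset[OF _ finitely_many_partition_on[of A]])
     (auto simp: sized_partitions_def)

lemma card_sized_partitions_le:
  assumes "finite A" and "card A = sum_list x"
  shows "card (sized_partitions A x) \<le> num_partitions x"
proof -
  have "card A = card {1..sum_list x}"
    using assms by simp
  then obtain f where f: "bij_betw f A {1..sum_list x}"
    using assms(1) finite_same_card_bij by blast
  then have inj: "inj_on f A" and im: "f ` A = {1..sum_list x}"
    by (auto simp: bij_betw_def)
  have "(`) ((`) f) P \<in> sized_partitions {1..sum_list x} x"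
    if P: "P \<in> sized_partitions A x" for P
  proof -
    have part: "partition_on A P" and sizes: "image_mset card (mset_set P) = mset x"
      using P by (auto simp: sized_partitions_def)
    have sub: "P \<subseteq> Pow A" and ne: "{} \<notin> P"
      using part by (auto simp: partition_on_def)
    have "partition_on (f ` A) ((`) f ` P - {{}})"
      by (rule partition_on_inj_image[OF part inj])
    moreover have "(`) f ` P - {{}} = (`) f ` P"
      using ne by auto
    ultimately have part': "partition_on {1..sum_list x} ((`) f ` P)"
      using im by simp
    have "inj_on ((`) f) P"
      using inj_on_subset[OF inj_on_image_Pow[OF inj] sub] .
    then have "mset_set ((`) f ` P) = image_mset ((`) f) (mset_set P)"
      by (simp add: image_mset_mset_set)
    then have "image_mset card (mset_set ((`) f ` P)) =
        image_mset (\<lambda>p. card (f ` p)) (mset_set P)"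
      by (simp add: multiset.map_comp o_def)
    also have "\<dots> = image_mset card (mset_set P)"
    proof (rule image_mset_cong)
      fix p assume "p \<in># mset_set P"
      then have "p \<subseteq> A"
        using sub finite_elements[OF assms(1) part] by auto
      then show "card (f ` p) = card p"
        using inj by (meson card_image inj_on_subset)
    qed
    finally have "image_mset card (mset_set ((`) f ` P)) = mset x"
      using sizes by simp
    with part' show ?thesis
      by (simp add: sized_partitions_def)
  qed
  moreover have "inj_on ((`) ((`) f)) (sized_partitions A x)"
    by (rule inj_on_subset[OF inj_on_image_Pow[OF inj_on_image_Pow[OF inj]]])
       (auto simp: sized_partitions_def partition_on_def)
  ultimately have "card (sized_partitions A x) \<le> card (sized_partitions {1..sum_list x} x)"
    by (intro card_inj_on_le[of "(`) ((`) f)"] finite_sized_partitions) auto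
  then show ?thesis
    by (simp add: num_partitions_def sized_partitions_def)
qed

section \<open>Encoding the orderings in which a given set is a union of arcs\<close>

text \<open>
  The data from which an ordering of \<open>{1..n}\<close> can be rebuilt when \<open>A\<close> is a union of
  arcs in it: a partition of \<open>A\<close>, for each part its elements as a list and the position
  (counted from \<open>0\<close>) where this list starts, and the elements outside \<open>A\<close> as a list.
  Not every such tuple comes from an ordering, since the positions assigned to different
  parts may overlap.
\<close>

type_synonym layout =
  "nat set set \<times> (nat set \<Rightarrow> nat list) \<times> (nat set \<Rightarrow> nat) \<times> nat list"

definition layouts :: "nat list \<Rightarrow> nat set \<Rightarrow> nat \<Rightarrow> layout set"
  where "layouts x A n =
    (SIGMA P : sized_partitions A x.
       (\<Pi>\<^sub>E p\<in>P. permutations_of_set p) \<times> (\<Pi>\<^sub>E p\<in>P. {..<n}) \<times>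
       permutations_of_set ({1..n} - A))"

lemma finite_layout_fiber:
  fixes A :: "nat set" and n :: nat
  assumes "finite A" and "P \<in> sized_partitions A x"
  shows "finite ((\<Pi>\<^sub>E p\<in>P. permutations_of_set p) \<times> (\<Pi>\<^sub>E p\<in>P. {..<n}) \<times>
    permutations_of_set ({1..n} - A))"
proof -
  have "finite P"
    using assms by (auto simp: sized_partitions_def intro: finite_elements)
  then show ?thesis
    by (intro finite_cartesian_product finite_PiE) auto
qed

lemma finite_layouts: "finite A \<Longrightarrow> finite (layouts x A n)"
  unfolding layouts_def
  by (intro finite_SigmaI finite_layout_fiber finite_sized_partitions)

lemma card_layouts_le:
  assumes A: "A \<subseteq> {1..n}" and card_A: "card A = sum_list x"
  shows "card (layouts x A n) \<le>
    num_partitions x * (\<Prod>i<length x. fact (x ! i)) * n ^ length x * fact (n - sum_list x)"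
    (is "_ \<le> num_partitions x * ?f * _ * _")
proof -
  let ?N = "?f * n ^ length x * fact (n - sum_list x)"
  have fin: "finite A"
    using A finite_subset by blast
  have rest: "card ({1..n} - A) = n - sum_list x"
    using A card_A fin by (simp add: card_Diff_subset)
  have fiber: "card ((\<Pi>\<^sub>E p\<in>P. permutations_of_set p) \<times> (\<Pi>\<^sub>E p\<in>P. {..<n}) \<times>
       permutations_of_set ({1..n} - A)) = ?N"
    if P: "P \<in> sized_partitions A x" for P
  proof -
    have part: "partition_on A P" and sizes: "image_mset card (mset_set P) = mset x"
      using P by (auto simp: sized_partitions_def)
    have fin_P: "finite P"
      using finite_elements[OF fin part] .
    have fin_p: "finite p" if "p \<in> P" for p
      using that part fin by (metis Union_upper finite_subset partition_onD1)
    have "card P = size (image_mset card (mset_set P))"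
      by simp
    then have card_P: "card P = length x"
      using sizes by simp
    have "(\<Prod>p\<in>P. card (permutations_of_set p)) = (\<Prod>p\<in>P. fact (card p))"
      using fin_p by (intro prod.cong) auto
    also have "\<dots> = prod_mset (image_mset fact (image_mset card (mset_set P)))"
      by (simp add: prod_unfold_prod_mset multiset.map_comp o_def)
    also have "\<dots> = prod_list (map fact x)"
      by (simp add: sizes prod_mset_prod_list flip: mset_map)
    also have "\<dots> = ?f"
      by (simp add: prod.list_conv_set_nth atLeast0LessThan)
    finally show ?thesis
      using fin_P card_P rest by (simp add: card_cartesian_product card_PiE)
  qed
  have "card (layouts x A n) = (\<Sum>P\<in>sized_partitions A x. ?N)"
    unfolding layouts_def
    using finite_layout_fiber[OF fin] fiber by (simp add: card_SigmaI finite_sized_partitions[OF fin])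
  also have "\<dots> \<le> num_partitions x * ?N"
    using card_sized_partitions_le[OF fin card_A] by simp
  finally show ?thesis
    by (simp add: mult.assoc)
qed

text \<open>
  The ordering \<open>cs\<close> agrees with the data: its elements outside \<open>A\<close> appear in the order
  \<open>rs\<close>, and reading cyclically from position \<open>s p\<close> gives the list \<open>L p\<close>.
\<close>

definition has_layout :: "nat set \<Rightarrow> nat list \<Rightarrow> layout \<Rightarrow> bool"
  where "has_layout A cs = (\<lambda>(P, L, s, rs).
    filter (\<lambda>v. v \<notin> A) cs = rs \<and>
    (\<forall>p\<in>P. \<forall>j<length (L p). cs ! ((s p + j) mod length cs) = L p ! j))"

text \<open>
  A list is determined by its entries in \<open>A\<close>, with their positions, and the list of its
  other entries.
\<close>

lemma eq_if_eq_on_and_filter_eq: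
  assumes "list_all2 (\<lambda>a b. a = b \<or> a \<notin> A \<and> b \<notin> A) xs ys"
    and "filter (\<lambda>v. v \<notin> A) xs = filter (\<lambda>v. v \<notin> A) ys"
  shows "xs = ys"
  using assms by (induction rule: list_all2_induct) (auto split: if_splits)

lemma layout_determines_position:
  assumes "distinct cs" "distinct ds" "length cs = length ds"
    and lay: "(P, L, s, rs) \<in> layouts x A n"
    and cs: "has_layout A cs (P, L, s, rs)" and ds: "has_layout A ds (P, L, s, rs)"
    and j: "j < length cs" and in_A: "cs ! j \<in> A"
  shows "cs ! j = ds ! j"
proof -
  have part: "partition_on A P"
    using lay by (auto simp: layouts_def sized_partitions_def)
  obtain p where p: "p \<in> P" "cs ! j \<in> p"
    using in_A partition_onD1[OF part] by auto
  have "L p \<in> permutations_of_set p"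
    using lay p by (auto simp: layouts_def PiE_iff)
  then have "set (L p) = p"
    by (rule permutations_of_setD)
  then obtain i where i: "i < length (L p)" "L p ! i = cs ! j"
    using p by (metis in_set_conv_nth)
  let ?q = "(s p + i) mod length cs"
  have cs_q: "cs ! ?q = L p ! i" and ds_q: "ds ! ?q = L p ! i"
    using cs ds p(1) i(1) assms(3) by (auto simp: has_layout_def)
  have "?q < length cs"
    using j by (intro mod_less_divisor) linarith
  then have "?q = j"
    using nth_eq_iff_index_eq[OF assms(1) _ j] cs_q i by simp
  then show ?thesis
    using ds_q i by simp
qed

lemma has_layout_unique:
  assumes "distinct cs" "distinct ds" "length cs = length ds"
    and "d \<in> layouts x A n" "has_layout A cs d" "has_layout A ds d"
  shows "cs = ds"
proof -
  obtain P L s rs where d: "d = (P, L, s, rs)"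
    by (cases d)
  show ?thesis
  proof (rule eq_if_eq_on_and_filter_eq)
    show "list_all2 (\<lambda>a b. a = b \<or> a \<notin> A \<and> b \<notin> A) cs ds"
      unfolding list_all2_conv_all_nth
    proof (intro conjI allI impI)
      fix j assume j: "j < length cs"
      note lay = assms(4-6)[unfolded d]
      have "cs ! j = ds ! j" if "cs ! j \<in> A"
        using layout_determines_position[OF assms(1-3) lay j that] .
      moreover have "ds ! j = cs ! j" if "ds ! j \<in> A"
        using layout_determines_position[OF assms(2,1) assms(3)[symmetric] lay(1,3,2) _ that]
          j assms(3) by simp
      ultimately show "cs ! j = ds ! j \<or> cs ! j \<notin> A \<and> ds ! j \<notin> A"
        by metis
    qed (rule assms(3))
    show "filter (\<lambda>v. v \<notin> A) cs = filter (\<lambda>v. v \<notin> A) ds"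
      using assms(5,6) by (simp add: d has_layout_def)
  qed
qed

text \<open>The arc \<open>arc cs t l\<close> as a list.\<close>

definition arc_list :: "nat list \<Rightarrow> nat \<Rightarrow> nat \<Rightarrow> nat list" where
  "arc_list cs t l = map (\<lambda>j. cs ! ((t + j) mod length cs)) [0..<l]"

lemma length_arc_list [simp]: "length (arc_list cs t l) = l"
  by (simp add: arc_list_def)

lemma set_arc_list: "set (arc_list cs t l) = arc cs t l"
proof -
  have "{t + 1..t + l} = (\<lambda>j. t + j + 1) ` {0..<l}"
  proof (intro equalityI subsetI)
    fix i assume "i \<in> {t + 1..t + l}"
    then have "i = t + (i - t - 1) + 1" "i - t - 1 \<in> {0..<l}"
      by auto
    then show "i \<in> (\<lambda>j. t + j + 1) ` {0..<l}"
      by blast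
  qed auto
  then show ?thesis
    by (simp add: arc_list_def arc_def image_image)
qed

lemma has_layout_exists:
  assumes pos: "\<forall>a \<in> set x. a > 0" and cs: "cs \<in> permutations_of_set {1..n}"
    and card_A: "card A = sum_list x" and n: "n > 0"
    and A: "(\<Union>i<length x. arc cs (t i) (x ! i)) = A"
  shows "\<exists>d \<in> layouts x A n. has_layout A cs d"
proof -
  define k where "k = length x"
  define l where "l i = arc_list cs (t i) (x ! i)" for i
  have len_cs: "length cs = n"
    using length_finite_permutations_of_set[OF cs] by simp
  have set_l: "set (l i) = arc cs (t i) (x ! i)" and len_l: "length (l i) = x ! i" for i
    by (simp_all add: l_def set_arc_list)
  have "length (concat (map l [0..<k])) = sum_list (map (\<lambda>i. x ! i) [0..<k])"
    by (simp add: length_concat o_def len_l)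
  also have "\<dots> = card A"
    by (simp add: k_def map_nth card_A)
  finally have len: "length (concat (map l [0..<k])) = card A" .
  have set_concat: "set (concat (map l [0..<k])) = A"
    using A by (auto simp: set_l k_def)
  \<comment> \<open>The lists have total length \<open>|A|\<close> and cover \<open>A\<close>, which leaves no room for repetitions.\<close>
  have dist: "distinct (concat (map l [0..<k]))"
    using len set_concat by (intro card_distinct) simp
  have nonempty: "l i \<noteq> []" if "i < k" for i
  proof -
    have "x ! i > 0"
      using pos that by (simp add: k_def)
    then show ?thesis
      using len_l[of i] by auto
  qed
  then have "[] \<notin> l ` {0..<k}"
    by fastforce
  then have "removeAll [] (map l [0..<k]) = map l [0..<k]"
    by (intro removeAll_id) simp
  then have dist_map: "distinct (map l [0..<k])"
    and dist_l: "\<And>i. i < k \<Longrightarrow> distinct (l i)"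
    and disj: "\<And>i j. i < k \<Longrightarrow> j < k \<Longrightarrow> l i \<noteq> l j \<Longrightarrow> set (l i) \<inter> set (l j) = {}"
    using dist unfolding distinct_concat_iff by auto
  have inj_l: "inj_on l {..<k}"
    using dist_map by (simp add: distinct_map atLeast0LessThan)
  define q where "q i = set (l i)" for i
  have disj_q: "q i \<inter> q j = {}" if "i < k" "j < k" "i \<noteq> j" for i j
    unfolding q_def using that inj_l by (intro disj) (auto dest: inj_onD)
  have q_nonempty: "q i \<noteq> {}" if "i < k" for i
    using nonempty[OF that] by (simp add: q_def)
  have inj_q: "inj_on q {..<k}"
    using disj_q q_nonempty by (intro inj_onI) (metis Int_absorb lessThan_iff)
  define P where "P = q ` {..<k}"
  have part: "partition_on A P"
  proof (rule partition_onI)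
    show "\<Union>P = A"
      using A by (simp add: P_def q_def set_l k_def)
    show "disjnt p p'" if "p \<in> P" "p' \<in> P" "p \<noteq> p'" for p p'
      using that disj_q unfolding P_def disjnt_def by blast
    show "{} \<notin> P"
      using q_nonempty by (auto simp: P_def)
  qed
  have card_q: "card (q i) = x ! i" if "i < k" for i
    using distinct_card[OF dist_l[OF that]] by (simp add: q_def len_l)
  have "image_mset card (mset_set P) = image_mset (\<lambda>i. card (q i)) (mset_set {..<k})"
    unfolding P_def using inj_q by (simp add: multiset.map_comp o_def flip: image_mset_mset_set)
  also have "\<dots> = image_mset (\<lambda>i. x ! i) (mset_set {..<k})"
    using card_q by (intro image_mset_cong) auto
  also have "\<dots> = mset (map (\<lambda>i. x ! i) [0..<k])"
    by (simp add: mset_upt atLeast0LessThan)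
  also have "\<dots> = mset x"
    by (simp add: k_def map_nth)
  finally have P: "P \<in> sized_partitions A x"
    using part by (simp add: sized_partitions_def)
  define idx where "idx = inv_into {..<k} q"
  have idx: "idx p < k" "q (idx p) = p" if "p \<in> P" for p
    using that inv_into_into[of p q "{..<k}"] f_inv_into_f[of p q "{..<k}"]
    by (auto simp: P_def idx_def)
  define L where "L = (\<lambda>p\<in>P. l (idx p))"
  define s where "s = (\<lambda>p\<in>P. t (idx p) mod n)"
  define rs where "rs = filter (\<lambda>v. v \<notin> A) cs"
  have "L \<in> (\<Pi>\<^sub>E p\<in>P. permutations_of_set p)"
    unfolding L_def
  proof (rule restrict_PiE_iff[THEN iffD2], rule ballI)
    fix p assume "p \<in> P"
    then show "l (idx p) \<in> permutations_of_set p"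
      using idx[of p] dist_l[of "idx p"] by (intro permutations_of_setI) (simp_all add: q_def)
  qed
  moreover have "s \<in> (\<Pi>\<^sub>E p\<in>P. {..<n})"
    using n by (auto simp: s_def)
  moreover have "rs \<in> permutations_of_set ({1..n} - A)"
    unfolding rs_def
  proof (rule permutations_of_setI)
    show "set (filter (\<lambda>v. v \<notin> A) cs) = {1..n} - A"
      using permutations_of_setD(1)[OF cs] by (simp add: set_diff_eq)
    show "distinct (filter (\<lambda>v. v \<notin> A) cs)"
      using permutations_of_setD(2)[OF cs] by simp
  qed
  ultimately have "(P, L, s, rs) \<in> layouts x A n"
    unfolding layouts_def by (intro SigmaI P)
  moreover have "has_layout A cs (P, L, s, rs)"
    by (simp add: has_layout_def rs_def L_def s_def l_def arc_list_def len_cs mod_add_left_eq)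
  ultimately show ?thesis
    by blast
qed

lemma card_cycles_covering_le:
  assumes pos: "\<forall>a \<in> set x. a > 0" and A: "A \<subseteq> {1..n}" and card_A: "card A = sum_list x"
    and n: "n > 0"
  shows "card {cs \<in> hamilton_cycles n. \<exists>t. (\<Union>i<length x. arc cs (t i) (x ! i)) = A} \<le>
    num_partitions x * (\<Prod>i<length x. fact (x ! i)) * n ^ length x * fact (n - sum_list x)"
    (is "card ?C \<le> _")
proof -
  have ex: "\<exists>d. d \<in> layouts x A n \<and> has_layout A cs d" if cs: "cs \<in> ?C" for cs
  proof -
    have perm: "cs \<in> permutations_of_set {1..n}"
      using cs by (simp add: hamilton_cycles_def)
    obtain t where "(\<Union>i<length x. arc cs (t i) (x ! i)) = A"
      using cs by blast
    from has_layout_exists[OF pos perm card_A n this] show ?thesis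
      by (simp only: Bex_def)
  qed
  define code where "code cs = (SOME d. d \<in> layouts x A n \<and> has_layout A cs d)" for cs
  have code: "code cs \<in> layouts x A n" "has_layout A cs (code cs)" if "cs \<in> ?C" for cs
    using someI_ex[OF ex[OF that]] by (auto simp: code_def)
  have "inj_on code ?C"
  proof (rule inj_onI)
    fix cs ds assume *: "cs \<in> ?C" "ds \<in> ?C" "code cs = code ds"
    then have perm: "cs \<in> permutations_of_set {1..n}" "ds \<in> permutations_of_set {1..n}"
      by (auto simp: hamilton_cycles_def)
    show "cs = ds"
    proof (rule has_layout_unique)
      show "distinct cs" "distinct ds"
        using perm permutations_of_setD(2) by blast+
      show "length cs = length ds"
        using perm by (simp add: length_finite_permutations_of_set)
      show "code cs \<in> layouts x A n" "has_layout A cs (code cs)" "has_layout A ds (code cs)"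
        using code[OF *(1)] code[OF *(2)] *(3) by auto
    qed
  qed
  moreover have "finite (layouts x A n)"
    by (rule finite_layouts[OF finite_subset[OF A finite_atLeastAtMost]])
  ultimately have "card ?C \<le> card (layouts x A n)"
    using code(1) by (intro card_inj_on_le[of code] image_subsetI)
  also note card_layouts_le[OF A card_A]
  finally show ?thesis .
qed

section \<open>Families that meet every cycle\<close>

lemma fact_le_card_family:
  assumes pos: "\<forall>a \<in> set x. a > 0" and n: "n > 0"
    and F: "F \<subseteq> r_subsets n (sum_list x)"
    and none: "\<not> (\<exists>cs \<in> hamilton_cycles n. acceptable x F cs)"
  shows "fact n \<le> card F *
    (num_partitions x * (\<Prod>i<length x. fact (x ! i)) * n ^ length x * fact (n - sum_list x))"
    (is "_ \<le> card F * ?N")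
proof -
  let ?C = "\<lambda>A. {cs \<in> hamilton_cycles n. \<exists>t. (\<Union>i<length x. arc cs (t i) (x ! i)) = A}"
  have fin: "finite F"
    by (rule finite_subset[OF F]) (simp add: r_subsets_def)
  have fin_H: "finite (hamilton_cycles n)"
    by (simp add: hamilton_cycles_def)
  have "hamilton_cycles n \<subseteq> (\<Union>A\<in>F. ?C A)"
    using none by (auto simp: acceptable_def)
  then have "card (hamilton_cycles n) \<le> card (\<Union>A\<in>F. ?C A)"
    using fin fin_H by (intro card_mono) auto
  also have "\<dots> \<le> (\<Sum>A\<in>F. card (?C A))"
    by (rule card_UN_le[OF fin])
  also have "\<dots> \<le> (\<Sum>A\<in>F. ?N)"
    using F by (intro sum_mono card_cycles_covering_le[OF pos _ _ n]) (auto simp: r_subsets_def)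
  finally show ?thesis
    by (simp add: hamilton_cycles_def)
qed

text \<open>
  The family of all \<open>r\<close>-sets admits no acceptable cycle, because consecutive arcs
  starting at the first position cover the first \<open>r\<close> entries. So the minimum defining
  \<open>m x n\<close> ranges over a nonempty set.
\<close>

lemma not_acceptable_r_subsets:
  assumes cs: "cs \<in> hamilton_cycles n" and n: "sum_list x \<le> n"
  shows "\<not> acceptable x (r_subsets n (sum_list x)) cs"
proof -
  have perm: "cs \<in> permutations_of_set {1..n}"
    using cs by (simp only: hamilton_cycles_def)
  have cs': "set cs = {1..n}" "distinct cs" "length cs = n"
    using permutations_of_setD[OF perm] length_finite_permutations_of_set[OF perm] by simp_all
  have "(\<Union>i<length ys. arc cs (sum_list (take i ys)) (ys ! i)) = set (take (sum_list ys) cs)"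
    if "sum_list ys \<le> n" for ys
    using that
  proof (induction ys rule: rev_induct)
    case (snoc a ys)
    let ?s = "sum_list ys"
    have "(\<Union>i<length (ys @ [a]). arc cs (sum_list (take i (ys @ [a]))) ((ys @ [a]) ! i)) =
        arc cs ?s a \<union> (\<Union>i<length ys. arc cs (sum_list (take i ys)) (ys ! i))"
      by (auto simp: lessThan_Suc nth_append)
    also have "\<dots> = arc cs ?s a \<union> set (take ?s cs)"
      using snoc by simp
    also have "arc_list cs ?s a = take a (drop ?s cs)"
      using snoc.prems cs'(3) by (intro nth_equalityI) (auto simp: arc_list_def)
    then have "arc cs ?s a = set (take a (drop ?s cs))"
      by (simp flip: set_arc_list)
    also have "\<dots> \<union> set (take ?s cs) = set (take (sum_list (ys @ [a])) cs)"
      by (auto simp: take_add)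
    finally show ?case .
  qed simp
  from this[OF n] have "(\<Union>i<length x. arc cs (sum_list (take i x)) (x ! i)) =
      set (take (sum_list x) cs)" .
  moreover have "set (take (sum_list x) cs) \<in> r_subsets n (sum_list x)"
    using cs' n set_take_subset[of "sum_list x" cs]
    by (auto simp: r_subsets_def distinct_card)
  ultimately have "(\<Union>i<length x. arc cs (sum_list (take i x)) (x ! i))
      \<in> r_subsets n (sum_list x)"
    by simp
  then show ?thesis
    by (auto simp: acceptable_def intro: exI[of _ "\<lambda>i. sum_list (take i x)"])
qed

lemma m_attained:
  assumes "sum_list x \<le> n"
  obtains F where "F \<subseteq> r_subsets n (sum_list x)"
    "\<not> (\<exists>cs \<in> hamilton_cycles n. acceptable x F cs)" "m x n = card F"
proof -
  let ?\<F> = "{F. F \<subseteq> r_subsets n (sum_list x) \<and>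
    \<not> (\<exists>cs \<in> hamilton_cycles n. acceptable x F cs)}"
  have "finite (Pow (r_subsets n (sum_list x)))"
    by (simp add: r_subsets_def)
  then have "finite ?\<F>"
    by (rule rev_finite_subset) auto
  moreover have "r_subsets n (sum_list x) \<in> ?\<F>"
    using assms not_acceptable_r_subsets by blast
  ultimately have "m x n \<in> card ` ?\<F>"
    unfolding m_def by (intro Min_in) auto
  then show ?thesis
    using that by blast
qed

section \<open>Asymptotics\<close>

lemma fact_eq_prod_ratio:
  assumes "r \<le> n"
  shows "(fact n :: real) = fact (n - r) * (real n ^ r * (\<Prod>i<r. 1 - real i / real n))"
  using assms
proof (induction r)
  case (Suc r)
  have "(fact (n - r) :: real) = real (n - r) * fact (n - Suc r)"
    using Suc.prems by (simp add: fact_reduce)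
  also have "real (n - r) = real n * (1 - real r / real n)"
    using Suc.prems by (simp add: field_simps of_nat_diff)
  finally show ?case
    using Suc by simp
qed simp

lemma tendsto_prod_ratio: "(\<lambda>n. \<Prod>i<r. 1 - real i / real n) \<longlonglongrightarrow> 1"
proof -
  have "(\<lambda>n. \<Prod>i<r. 1 - real i / real n) \<longlonglongrightarrow> (\<Prod>i<r. 1 - 0)"
    by (intro tendsto_prod tendsto_diff tendsto_const lim_const_over_n)
  then show ?thesis
    by simp
qed

theorem theorem14:
  fixes x :: "nat list" and r k :: nat
  assumes "x \<noteq> []"
    and "\<forall>a \<in> set x. a > 0"
    and "k = length x"
    and "r = sum_list x"
  shows "\<exists>\<epsilon> :: nat \<Rightarrow> real. \<epsilon> \<longlonglongrightarrow> 0 \<and>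
    (\<forall>n \<ge> r. real (m x n) \<ge>
       (1 / (real (num_partitions x) * (\<Prod>i<k. fact (x ! i))) + \<epsilon> n) * real n ^ (r - k))"
proof -
  define K :: real where "K = real (num_partitions x) * (\<Prod>i<k. fact (x ! i))"
  define q where "q n = (\<Prod>i<r. 1 - real i / real n)" for n
  define \<epsilon> where "\<epsilon> n = (q n - 1) / K" for n
  have "(\<lambda>n. (q n - 1) / K) \<longlonglongrightarrow> (1 - 1) / K"
    unfolding q_def divide_inverse[of _ K]
    by (intro tendsto_mult tendsto_diff tendsto_const tendsto_prod_ratio)
  then have lim: "\<epsilon> \<longlonglongrightarrow> 0"
    by (simp add: \<epsilon>_def[abs_def])
  have k_le: "k \<le> r"
  proof -
    have "(\<Sum>a\<leftarrow>x. 1) \<le> (\<Sum>a\<leftarrow>x. a)"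
      using assms(2) by (intro sum_list_mono) (simp add: Suc_leI)
    then show ?thesis
      using assms(3,4) by (simp add: sum_list_triv)
  qed
  have "k > 0"
    using assms(1,3) by simp
  have "(1 / K + \<epsilon> n) * real n ^ (r - k) \<le> real (m x n)" if n: "n \<ge> r" for n
  proof -
    have n_pos: "n > 0"
      using n k_le \<open>k > 0\<close> by simp
    obtain F where F: "F \<subseteq> r_subsets n (sum_list x)"
      "\<not> (\<exists>cs \<in> hamilton_cycles n. acceptable x F cs)" "m x n = card F"
      by (rule m_attained[OF n[unfolded assms(4)]])
    have "real (fact n) \<le> real (m x n *
        (num_partitions x * (\<Prod>i<k. fact (x ! i)) * n ^ k * fact (n - r)))"
      using fact_le_card_family[OF assms(2) n_pos F(1,2)] F(3) assms(3,4)
      by (intro of_nat_mono) simp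
    then have "fact (n - r) * (real n ^ r * q n) \<le> fact (n - r) * (real (m x n) * K * real n ^ k)"
      using fact_eq_prod_ratio[OF n] by (simp add: q_def K_def mult_ac)
    then have "real n ^ r * q n \<le> real (m x n) * K * real n ^ k"
      by simp
    moreover have "real n ^ r = real n ^ (r - k) * real n ^ k"
      using k_le by (simp flip: power_add)
    ultimately have "(real n ^ (r - k) * q n) * real n ^ k \<le> (real (m x n) * K) * real n ^ k"
      by (simp add: mult_ac)
    then have main: "real n ^ (r - k) * q n \<le> real (m x n) * K"
      using n_pos by (simp add: mult_le_cancel_right)
    have "K \<ge> 0"
      unfolding K_def by (intro mult_nonneg_nonneg prod_nonneg) auto
    have "(1 / K + \<epsilon> n) * real n ^ (r - k) = (real n ^ (r - k) * q n) / K"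
      by (simp add: \<epsilon>_def diff_divide_distrib)
    also have "\<dots> \<le> real (m x n)"
    \<comment> \<open>If \<open>K = 0\<close>, the left side is \<open>0\<close> by the convention for division by zero.\<close>
    proof (cases "K = 0")
      case False
      then show ?thesis
        using main \<open>K \<ge> 0\<close> by (simp add: pos_divide_le_eq)
    qed simp
    finally show ?thesis .
  qed
  then show ?thesis
    using lim unfolding K_def by (intro exI[of _ \<epsilon>] conjI allI impI)
qed

end
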